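(* Let $S\subseteq\mathbb{N}^d$ be an affine semigroup such that $\mathcal{H}(S)$ is a non-empty finite set. Then: (i) $\mathrm{PF}(S)=\mathrm{Maximals}_{\le}\,\mathcal{H}(S)$, the set of maximal elements of $(\mathcal{H}(S),\le)$. (ii) Let $x\in\mathbb{N}^d$. Then $x\in\mathcal{H}(S)$ if and only if $f-x\in S$ for some $f\in\mathrm{PF}(S)$.
   Context: $\mathbb{N}$ denotes the non-negative integers. An affine semigroup $S$ is a finitely generated submonoid of $\mathbb{N}^d$, with minimal generating set $\{a_1,\dots,a_n\}$. Put $\mathrm{cone}(S)=\{\sum_{i=1}^n\lambda_i a_i\mid \lambda_i\in\mathbb{Q}_{\ge 0}\}$ and $\mathcal{H}(S)=(\mathrm{cone}(S)\setminus S)\cap\mathbb{N}^d$. The set of pseudo-Frobenius elements is $\mathrm{PF}(S)=\{f\in\mathcal{H}(S)\mid f+s\in S \text{ for all } s\in S\setminus\{0\}\}$. On $\mathcal{H}(S)$ the partial order $\le$ is: $x\le y$ if and only if $y-x\in S$.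
   Formalization: In (ii) the condition x ∈ cone(S) is added to "f−x ∈ S for some f ∈ PF(S)"; without it (ii) fails: for S = {(a,b) ∈ ℕ² : b ≤ a} \ {(1,1)}, PF(S) = H(S) = {(1,1)} and (1,1)−(0,1) = (1,0) ∈ S, but (0,1) ∉ H(S). *)

theory Defs
  imports "HOL-Analysis.Analysis"
begin

text \<open>The lattice of \<open>d\<close>-tuples of natural numbers is realised inside the rational vector space
  \<open>rat ^ 'd\<close>, with \<open>d = CARD('d)\<close>. Thus rational cones and the differences \<open>y - x\<close> in the statement
  are the ordinary ones; on \<open>nat ^ 'd\<close> subtraction would be truncated.\<close>

definition nat_vectors :: "(rat ^ 'd) set" where
  "nat_vectors = {x. \<forall>i. x $ i \<in> \<nat>}"

definition additive_submonoid :: "('a::comm_monoid_add) set \<Rightarrow> bool" where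
  "additive_submonoid M \<longleftrightarrow> 0 \<in> M \<and> (\<forall>x\<in>M. \<forall>y\<in>M. x + y \<in> M)"

definition generates :: "('a::comm_monoid_add) set \<Rightarrow> 'a set \<Rightarrow> bool" where
  "generates A M \<longleftrightarrow> additive_submonoid hull A = M"

definition affine_semigroup :: "(rat ^ 'd) set \<Rightarrow> bool" where
  "affine_semigroup S \<longleftrightarrow>
     additive_submonoid S \<and> S \<subseteq> nat_vectors \<and> (\<exists>A. finite A \<and> generates A S)"

definition minimal_generating_set :: "('a::comm_monoid_add) set \<Rightarrow> 'a set \<Rightarrow> bool" where
  "minimal_generating_set A M \<longleftrightarrow> generates A M \<and> (\<forall>B. B \<subset> A \<longrightarrow> \<not> generates B M)"

text \<open>The minimal generating set of an affine semigroup is unique and finite; see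
  \<open>ex1_minimal_generating_set\<close> and \<open>finite_minimal_generators\<close> below.\<close>

definition minimal_generators :: "('a::comm_monoid_add) set \<Rightarrow> 'a set" where
  "minimal_generators M = (THE A. minimal_generating_set A M)"

definition rational_cone :: "(rat ^ 'd) set \<Rightarrow> (rat ^ 'd) set" where
  "rational_cone S =
     {\<Sum>a\<in>minimal_generators S. l a *s a | l. \<forall>a\<in>minimal_generators S. 0 \<le> l a}"

definition gaps :: "(rat ^ 'd) set \<Rightarrow> (rat ^ 'd) set" where
  "gaps S = (rational_cone S - S) \<inter> nat_vectors"

text \<open>In the description of \<open>gaps S\<close> by the condition \<open>f - x \<in> S\<close> with \<open>f \<in> pseudo_Frobenius S\<close>, the
  membership \<open>x \<in> rational_cone S\<close> cannot be dropped: if \<open>S\<close> consists of all pairs \<open>(a, b)\<close> of natural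
  numbers with \<open>b \<le> a\<close> except \<open>(1, 1)\<close>, then \<open>(1, 1)\<close> is the only gap and the only pseudo-Frobenius
  element, and \<open>(1, 1) - (0, 1) = (1, 0) \<in> S\<close>, but \<open>(0, 1)\<close> lies outside the cone. For \<open>d = 1\<close>
  the condition \<open>x \<in> rational_cone S\<close> is automatic (as \<open>gaps S \<noteq> {}\<close> forces \<open>S \<noteq> {0}\<close>).\<close>

definition pseudo_Frobenius :: "(rat ^ 'd) set \<Rightarrow> (rat ^ 'd) set" where
  "pseudo_Frobenius S = {f \<in> gaps S. \<forall>s\<in>S - {0}. f + s \<in> S}"

definition semigroup_le :: "(rat ^ 'd) set \<Rightarrow> rat ^ 'd \<Rightarrow> rat ^ 'd \<Rightarrow> bool" where
  "semigroup_le S x y \<longleftrightarrow> y - x \<in> S"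

definition maximals :: "('a \<Rightarrow> 'a \<Rightarrow> bool) \<Rightarrow> 'a set \<Rightarrow> 'a set" where
  "maximals le X = {x \<in> X. \<forall>y\<in>X. le x y \<longrightarrow> y = x}"

lemma additive_submonoid_hull: "additive_submonoid (additive_submonoid hull A)"
  by (rule hull_in) (auto simp: additive_submonoid_def)

lemma minimal_generating_set_subset:
  fixes A B S :: "(rat ^ 'd) set"
  assumes S: "S \<subseteq> nat_vectors" and A: "minimal_generating_set A S" and B: "generates B S"
  shows "A \<subseteq> B"
proof
  fix a assume a: "a \<in> A"
  define H where "H = additive_submonoid hull (A - {a})"
  define w where "w = (\<lambda>x :: rat ^ 'd. \<Sum>i\<in>UNIV. x $ i)"
  have w_add: "w (x + y) = w x + w y" for x y by (simp add: w_def sum.distrib)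
  have nonneg: "0 \<le> x $ i" if "x \<in> nat_vectors" for x :: "rat ^ 'd" and i
    using that by (auto simp: nat_vectors_def elim!: allE[of _ i] Nats_cases)
  have w_ge: "0 \<le> w x" if "x \<in> nat_vectors" for x
    unfolding w_def by (rule sum_nonneg) (use nonneg[OF that] in auto)
  have w_pos: "0 < w x" if x: "x \<in> nat_vectors" and "x \<noteq> 0" for x
  proof -
    obtain i where "x $ i \<noteq> 0" using \<open>x \<noteq> 0\<close> by (auto simp: vec_eq_iff)
    then have "0 < x $ i" using nonneg[OF x, of i] by simp
    then show ?thesis unfolding w_def
      by (intro sum_pos2[where i = i]) (use nonneg[OF x] in auto)
  qed
  have genA: "additive_submonoid hull A = S" and genB: "additive_submonoid hull B = S"
    using A B by (auto simp: minimal_generating_set_def generates_def)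
  have subS: "additive_submonoid S" using additive_submonoid_hull[of A] genA by simp
  have AS: "A \<subseteq> S" and BS: "B \<subseteq> S" using genA genB hull_subset by metis+
  have subH: "additive_submonoid H" unfolding H_def by (rule additive_submonoid_hull)
  have H_S: "H \<subseteq> S" unfolding H_def genA[symmetric] by (rule hull_mono) auto
  have aH: "a \<notin> H"
  proof
    assume "a \<in> H"
    then have "A \<subseteq> H" unfolding H_def using hull_subset[of "A - {a}" additive_submonoid] by auto
    then have "S \<subseteq> H" unfolding genA[symmetric] by (rule hull_minimal) (rule subH)
    with H_S have "generates (A - {a}) S" by (auto simp: generates_def H_def)
    moreover have "A - {a} \<subset> A" using a by auto
    ultimately show False using A unfolding minimal_generating_set_def by blast
  qed
  have a0: "a \<noteq> 0" using aH subH by (auto simp: additive_submonoid_def)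
  define T where "T = {s \<in> S. s \<in> H \<or> w a \<le> w s}"
  have "additive_submonoid T"
    unfolding additive_submonoid_def
  proof (intro conjI ballI)
    show "0 \<in> T" using subS subH by (auto simp: T_def additive_submonoid_def)
    fix x y assume xy: "x \<in> T" "y \<in> T"
    then have "0 \<le> w x" "0 \<le> w y" using S w_ge by (auto simp: T_def)
    then show "x + y \<in> T" using xy subS subH
      by (auto simp: T_def additive_submonoid_def w_add)
  qed
  moreover have "A \<subseteq> T"
    using AS hull_subset[of "A - {a}" additive_submonoid] by (auto simp: T_def H_def)
  ultimately have ST: "S \<subseteq> T" unfolding genA[symmetric] by (metis hull_minimal)
  have atom: "u = 0 \<or> v = 0" if u: "u \<in> S" and v: "v \<in> S" and uv: "u + v = a" for u v
  proof (rule ccontr)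
    assume "\<not> ?thesis"
    then have "0 < w u" "0 < w v" using u v S w_pos by auto
    moreover have "w a = w u + w v" using w_add uv by metis
    ultimately have "u \<in> H" "v \<in> H" using ST u v by (auto simp: T_def)
    then show False using subH uv aH by (auto simp: additive_submonoid_def)
  qed
  show "a \<in> B"
  proof (rule ccontr)
    assume "a \<notin> B"
    have "additive_submonoid (S - {a})"
      unfolding additive_submonoid_def
    proof (intro conjI ballI)
      show "0 \<in> S - {a}" using subS a0 by (auto simp: additive_submonoid_def)
      fix x y assume "x \<in> S - {a}" "y \<in> S - {a}"
      then show "x + y \<in> S - {a}" using atom[of x y] subS
        by (auto simp: additive_submonoid_def)
    qed
    moreover have "B \<subseteq> S - {a}" using BS \<open>a \<notin> B\<close> by auto
    ultimately have "S \<subseteq> S - {a}" unfolding genB[symmetric] by (metis hull_minimal)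
    then show False using a AS by auto
  qed
qed

lemma ex1_minimal_generating_set:
  assumes "affine_semigroup S"
  shows "\<exists>!A. minimal_generating_set A S"
proof -
  have S: "S \<subseteq> nat_vectors" using assms by (simp add: affine_semigroup_def)
  obtain A where A: "finite A" "generates A S" using assms by (auto simp: affine_semigroup_def)
  obtain B where B: "B \<subseteq> A" "generates B S"
      and Bmin: "\<And>C. C \<subseteq> A \<Longrightarrow> generates C S \<Longrightarrow> card B \<le> card C"
    using ex_has_least_nat[of "\<lambda>B. B \<subseteq> A \<and> generates B S" A card] A by blast
  have "finite B" using A B by (blast intro: finite_subset)
  then have "minimal_generating_set B S"
    unfolding minimal_generating_set_def
    using B Bmin by (metis not_less psubset_card_mono psubset_imp_subset subset_trans)
  then show ?thesis
    using minimal_generating_set_subset[OF S]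
    by (metis minimal_generating_set_def subset_antisym)
qed

lemma minimal_generators:
  assumes "affine_semigroup S"
  shows "minimal_generating_set (minimal_generators S) S"
  unfolding minimal_generators_def by (rule theI') (rule ex1_minimal_generating_set[OF assms])

lemma finite_minimal_generators:
  assumes "affine_semigroup S"
  shows "finite (minimal_generators S)"
  using assms minimal_generators[OF assms] minimal_generating_set_subset finite_subset
  unfolding affine_semigroup_def by metis

end

theory Submission
  imports Defs
begin

text \<open>Since the semigroup is contained in the cone and the cone is closed under addition, adding an
  element of the semigroup to a gap gives either a gap or an element of the semigroup. Hence the
  pseudo-Frobenius elements are the maximal gaps, and finiteness puts a maximal gap above every
  gap.\<close>

lemma generator_in_rational_cone:
  assumes "affine_semigroup S" "a \<in> minimal_generators S"
  shows "a \<in> rational_cone S"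
proof -
  \<comment> \<open>The indicator of \<open>a\<close> serves as coefficient function. Finiteness of
    the generating set matters for the collapse, since a sum over an infinite set is 0 by
    convention.\<close>
  have "(\<Sum>b\<in>minimal_generators S. (if b = a then 1 else 0) *s b) =
      (\<Sum>b\<in>minimal_generators S. if b = a then b else 0)"
    by (rule sum.cong) auto
  also have "\<dots> = a"
    using assms by (simp add: finite_minimal_generators)
  finally show ?thesis
    unfolding rational_cone_def by (auto intro!: exI[of _ "\<lambda>b. if b = a then 1 else 0"])
qed

lemma additive_submonoid_rational_cone: "additive_submonoid (rational_cone S)"
  unfolding additive_submonoid_def
proof (intro conjI ballI)
  show "0 \<in> rational_cone S"
    unfolding rational_cone_def by (auto intro!: exI[of _ "\<lambda>_. 0"])
next
  fix x y assume "x \<in> rational_cone S" "y \<in> rational_cone S"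
  then obtain k l where
    "x = (\<Sum>a\<in>minimal_generators S. k a *s a)" "\<forall>a\<in>minimal_generators S. 0 \<le> k a"
    "y = (\<Sum>a\<in>minimal_generators S. l a *s a)" "\<forall>a\<in>minimal_generators S. 0 \<le> l a"
    unfolding rational_cone_def by blast
  then show "x + y \<in> rational_cone S"
    unfolding rational_cone_def
    by (auto intro!: exI[of _ "\<lambda>a. k a + l a"] simp: sum.distrib vector_sadd_rdistrib)
qed

text \<open>The cone is a submonoid containing the minimal generators, hence contains their hull,
  which is \<open>S\<close>.\<close>

lemma affine_semigroup_subset_rational_cone:
  assumes "affine_semigroup S"
  shows "S \<subseteq> rational_cone S"
proof -
  have "additive_submonoid hull minimal_generators S \<subseteq> rational_cone S"
    using assms
    by (intro hull_minimal subsetI generator_in_rational_cone additive_submonoid_rational_cone)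
  then show ?thesis
    using minimal_generators[OF assms] by (simp add: minimal_generating_set_def generates_def)
qed

lemma additive_submonoid_nat_vectors: "additive_submonoid nat_vectors"
  by (auto simp: additive_submonoid_def nat_vectors_def)

text \<open>This yields antisymmetry of \<open>semigroup_le S\<close>, because \<open>S\<close> lies
  in \<open>nat_vectors\<close>.\<close>

lemma nat_vectors_antisym:
  assumes "x \<in> nat_vectors" "- x \<in> nat_vectors"
  shows "x = 0"
proof -
  have nonneg: "0 \<le> y $ i" if "y \<in> nat_vectors" for y :: "rat ^ 'a" and i
    using that by (auto simp: nat_vectors_def elim!: allE[of _ i] Nats_cases)
  have "x $ i = 0" for i
    using nonneg[OF assms(1), of i] nonneg[OF assms(2), of i] by simp
  then show ?thesis by (simp add: vec_eq_iff)
qed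

lemma gap_plus_in_gaps:
  assumes S: "affine_semigroup S" and f: "f \<in> gaps S" and s: "s \<in> S" and fs: "f + s \<notin> S"
  shows "f + s \<in> gaps S"
proof -
  have "s \<in> rational_cone S" "s \<in> nat_vectors"
    using affine_semigroup_subset_rational_cone[OF S] S s by (auto simp: affine_semigroup_def)
  then show ?thesis
    using f fs additive_submonoid_rational_cone[of S] additive_submonoid_nat_vectors
    by (auto simp: gaps_def additive_submonoid_def)
qed

lemma pseudo_Frobenius_eq_maximals:
  assumes "affine_semigroup S"
  shows "pseudo_Frobenius S = maximals (semigroup_le S) (gaps S)"
proof (intro equalityI subsetI)
  fix f assume f: "f \<in> pseudo_Frobenius S"
  have "y = f" if "y \<in> gaps S" "y - f \<in> S" for y
  proof (rule ccontr)
    assume "y \<noteq> f"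
    then have "y - f \<in> S - {0}" using that by simp
    \<comment> \<open>This sum is \<open>y\<close> itself, which as a gap lies outside
      \<open>S\<close>.\<close>
    then have "f + (y - f) \<in> S" using f unfolding pseudo_Frobenius_def by blast
    then show False using that by (simp add: gaps_def)
  qed
  then show "f \<in> maximals (semigroup_le S) (gaps S)"
    using f by (auto simp: maximals_def semigroup_le_def pseudo_Frobenius_def)
next
  fix f assume f: "f \<in> maximals (semigroup_le S) (gaps S)"
  then have "f \<in> gaps S" and max: "\<And>y. y \<in> gaps S \<Longrightarrow> y - f \<in> S \<Longrightarrow> y = f"
    by (auto simp: maximals_def semigroup_le_def)
  then show "f \<in> pseudo_Frobenius S"
    \<comment> \<open>If \<open>f + s\<close> were outside \<open>S\<close>, it would be a gap above
      \<open>f\<close>, so maximality would give \<open>f + s = f\<close>, that is,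
      \<open>s = 0\<close>.\<close>
    using gap_plus_in_gaps[OF assms] max[of "f + _"] by (fastforce simp: pseudo_Frobenius_def)
qed

lemma ex_maximal_gap_above:
  assumes S: "affine_semigroup S" and fin: "finite (gaps S)" and x: "x \<in> gaps S"
  shows "\<exists>f\<in>maximals (semigroup_le S) (gaps S). semigroup_le S x f"
proof -
  \<comment> \<open>Restricting to the gaps above \<open>x\<close> ensures that the maximal element
    found lies above \<open>x\<close>.\<close>
  define G where "G = {y \<in> gaps S. y - x \<in> S}"
  have sub: "additive_submonoid S" and SN: "S \<subseteq> nat_vectors"
    using S by (auto simp: affine_semigroup_def)
  have trans: "c - a \<in> S" if "b - a \<in> S" "c - b \<in> S" for a b c
  proof -
    have "(b - a) + (c - b) \<in> S" using sub that unfolding additive_submonoid_def by blast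
    then show ?thesis by simp
  qed
  have antisym: "a = b" if "b - a \<in> S" "a - b \<in> S" for a b
    using nat_vectors_antisym[of "b - a"] that SN by auto
  \<comment> \<open>The strict part of the order is used, as \<open>bex_max_element\<close> requires
    an asymmetric relation. Its transitivity also needs antisymmetry, to exclude
    \<open>a = c\<close> in a chain from \<open>a\<close> through \<open>b\<close> to
    \<open>c\<close>.\<close>
  have "\<exists>f\<in>G. \<forall>y\<in>G. y \<noteq> f \<longrightarrow> \<not> (f \<noteq> y \<and> y - f \<in> S)"
  proof (rule Finite_Set.bex_max_element)
    show "finite G" using fin by (simp add: G_def)
    show "G \<noteq> {}" using x sub by (auto simp: G_def additive_submonoid_def)
    show "asymp_on G (\<lambda>a b. a \<noteq> b \<and> b - a \<in> S)"
      using antisym by (auto intro!: asymp_onI)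
    show "transp_on G (\<lambda>a b. a \<noteq> b \<and> b - a \<in> S)"
      using antisym trans by (intro transp_onI) blast
  qed
  then obtain f where f: "f \<in> G" "\<And>y. y \<in> G \<Longrightarrow> y - f \<in> S \<Longrightarrow> y = f" by blast
  \<comment> \<open>\<open>G\<close> is upward closed among the gaps, so maximality in
    \<open>G\<close> is maximality in \<open>gaps S\<close>.\<close>
  moreover have "y \<in> G" if "y \<in> gaps S" "y - f \<in> S" for y
    using f that trans[of f x y] by (auto simp: G_def)
  ultimately show ?thesis
    by (auto simp: G_def maximals_def semigroup_le_def)
qed

theorem corollary2p15:
  fixes S :: "(rat ^ 'd) set"
  assumes "affine_semigroup S"
    and "gaps S \<noteq> {}"
    and "finite (gaps S)"
  shows "pseudo_Frobenius S = maximals (semigroup_le S) (gaps S)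
    \<and> (\<forall>x\<in>nat_vectors.
         x \<in> gaps S \<longleftrightarrow> x \<in> rational_cone S \<and> (\<exists>f\<in>pseudo_Frobenius S. f - x \<in> S))"
proof (intro conjI ballI iffI)
  show PF: "pseudo_Frobenius S = maximals (semigroup_le S) (gaps S)"
    by (rule pseudo_Frobenius_eq_maximals[OF assms(1)])
  fix x :: "rat ^ 'd" assume x: "x \<in> nat_vectors"
  {
    assume "x \<in> gaps S"
    then show "x \<in> rational_cone S" "\<exists>f\<in>pseudo_Frobenius S. f - x \<in> S"
      using ex_maximal_gap_above[OF assms(1,3)] unfolding PF
      by (auto simp: gaps_def semigroup_le_def)
  next
    assume r: "x \<in> rational_cone S \<and> (\<exists>f\<in>pseudo_Frobenius S. f - x \<in> S)"
    then obtain f where f: "f \<in> pseudo_Frobenius S" "f - x \<in> S" by blast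
    \<comment> \<open>Membership in the cone and in \<open>nat_vectors\<close> is given, so only
      this remains: otherwise \<open>f\<close>, as the sum of \<open>x\<close> and
      \<open>f - x\<close>, would lie in \<open>S\<close>.\<close>
    have "x \<notin> S"
    proof
      assume "x \<in> S"
      then have "x + (f - x) \<in> S"
        using f(2) assms(1) unfolding affine_semigroup_def additive_submonoid_def by blast
      then show False using f(1) by (simp add: pseudo_Frobenius_def gaps_def)
    qed
    then show "x \<in> gaps S" using r x by (simp add: gaps_def)
  }
qed

end
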